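(* Let $\theta\in(0,1]$, $(a_n)_{n=1}^\infty=\mathcal{G}(\theta)$, and $e_m=\theta-\sum_{n=1}^m 1/a_n$ for $m\geqslant 0$. Fix an integer $N\geqslant 2$, and for each $m\geqslant 1$ let $N/b_m$ (with $b_m\in\mathbb{N}$) be the largest fraction with numerator $N$ and positive integer denominator that is strictly smaller than $e_{m-1}$. If $\theta$ is rational, then for all sufficiently large $m$, $$\frac{1}{a_m}<\frac{N}{b_m}.$$
   Context: $\mathbb{N}$ is the set of positive integers. For $\theta\in(0,1]$ let $G(\theta)=\lfloor 1/\theta\rfloor+1$. The greedy algorithm $\mathcal{G}$ produces the sequence $\mathcal{G}(\theta)=(a_n)_{n=1}^\infty$ of positive integers defined by $a_1=G(\theta)$ and $a_m=G\left(\theta-\sum_{n=1}^{m-1}1/a_n\right)$ for $m\geqslant 2$. *)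

theory Defs
  imports Complex_Main
begin

text \<open>
  \<open>1 / greedy_step x\<close> is the largest unit fraction strictly below \<open>x\<close>, for \<open>0 < x \<le> 1\<close>;
  only positive arguments are relevant, so the truncation by \<open>nat\<close> never takes effect.
\<close>
definition greedy_step :: "real \<Rightarrow> nat" where
  "greedy_step x = nat \<lfloor>1 / x\<rfloor> + 1"

text \<open>
  Sequences are indexed from 1; the value at index 0 is a dummy. For \<open>m = 1\<close> the sum is empty.
\<close>
fun greedy :: "real \<Rightarrow> nat \<Rightarrow> nat" where
  "greedy \<theta> m =
     (if m = 0 then 0
      else greedy_step (\<theta> - (\<Sum>n\<in>{1..<m}. 1 / real (greedy \<theta> n))))"

declare greedy.simps [simp del]

lemma greedy_1: "greedy \<theta> 1 = greedy_step \<theta>"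
  by (subst greedy.simps) simp

lemma greedy_rec:
  assumes "m \<ge> 2"
  shows "greedy \<theta> m = greedy_step (\<theta> - (\<Sum>n = 1..m - 1. 1 / real (greedy \<theta> n)))"
proof -
  have "{1..<m} = {1..m - 1}" using assms by auto
  then show ?thesis using assms by (subst greedy.simps) simp
qed

end

theory Submission
  imports Defs
begin

text \<open>
  For \<open>x = p / q\<close> the greedy step leaves the remainder \<open>(p - q mod p) / (q * a)\<close>, whose numerator
  is smaller than \<open>p\<close> unless \<open>p\<close> divides \<open>q\<close>. Hence for rational \<open>\<theta>\<close> some remainder is a unit
  fraction \<open>1 / k\<close>, and from then on all are, because \<open>1 / k - 1 / (k + 1) = 1 / (k * (k + 1))\<close>.
  At such a remainder \<open>N / (N * k + 1)\<close> is admissible for \<open>N / b\<^sub>m\<close> and, as \<open>N \<ge> 2\<close>, it exceeds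
  \<open>1 / (k + 1) = 1 / a\<^sub>m\<close>.
\<close>

lemma greedy_Suc:
  "greedy \<theta> (Suc m) = greedy_step (\<theta> - (\<Sum>n = 1..m. 1 / real (greedy \<theta> n)))"
  by (subst greedy.simps) (simp add: atLeastLessThanSuc_atLeastAtMost)

lemma greedy_step_divide: "greedy_step (real p / real q) = q div p + 1"
  by (simp add: greedy_step_def floor_divide_of_nat_eq)

lemma greedy_step_inverse: "greedy_step (1 / real k) = k + 1"
  using greedy_step_divide[of 1 k] by simp

lemma greedy_step_remainder:
  assumes "p > 0" and "q > 0"
  shows "real p / real q - 1 / real (greedy_step (real p / real q))
       = real (p - q mod p) / real (q * (q div p + 1))"
proof -
  \<comment> \<open>This bound makes the truncated subtraction \<open>p - q mod p\<close> agree with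
    the real one.\<close>
  have "q mod p \<le> p" using assms by (simp add: less_imp_le)
  moreover have "real q = real p * real (q div p) + real (q mod p)"
    by (metis mult_div_mod_eq of_nat_add of_nat_mult)
  ultimately have "real (p - q mod p) = real p * real (q div p + 1) - real q"
    by (simp add: of_nat_diff algebra_simps)
  moreover have "real (q div p + 1) > 0" by simp
  ultimately show ?thesis
    unfolding greedy_step_divide using assms
    by (simp add: diff_frac_eq del: of_nat_add of_nat_Suc add_Suc_right mult_Suc_right)
qed

text \<open>Descent on the numerator. Since \<open>p\<close> and \<open>q\<close> need not be
  coprime, the unreduced fraction from \<open>greedy_step_remainder\<close> can be fed back into the
  induction.\<close>

lemma greedy_remainder_reaches_inverse:
  fixes e :: "nat \<Rightarrow> real"
  assumes step: "\<And>m. e (Suc m) = e m - 1 / real (greedy_step (e m))"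
    and "e m = real p / real q" and "p > 0" and "q > 0"
  shows "\<exists>M k. k > 0 \<and> e M = 1 / real k"
  using assms(2-)
proof (induction p arbitrary: m q rule: less_induct)
  case (less p)
  show ?case
  proof (cases "p dvd q")
    case True
    then obtain k where "q = p * k" by blast
    with less.prems have "k > 0 \<and> e m = 1 / real k" by simp
    then show ?thesis by blast
  next
    case False
    have "e (Suc m) = real (p - q mod p) / real (q * (q div p + 1))"
      using step[of m] greedy_step_remainder[OF less.prems(2,3)] less.prems(1) by simp
    \<comment> \<open>Non-divisibility puts \<open>q mod p\<close> strictly between 0 and
      \<open>p\<close>.\<close>
    moreover from False have "p - q mod p < p" "p - q mod p > 0"
      using less.prems by (auto simp: dvd_eq_mod_eq_0)
    ultimately show ?thesis
      using less.IH less.prems(3) by (metis add_gr_0 mult_pos_pos zero_less_one)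
  qed
qed

lemma greedy_remainder_stays_inverse:
  fixes e :: "nat \<Rightarrow> real"
  assumes step: "\<And>m. e (Suc m) = e m - 1 / real (greedy_step (e m))"
    and "k > 0" and "e M = 1 / real k" and "M \<le> m"
  shows "\<exists>k > 0. e m = 1 / real k"
  using \<open>M \<le> m\<close>
proof (induction m rule: dec_induct)
  case base
  then show ?case using assms by blast
next
  case (step n)
  then obtain j where "j > 0" "e n = 1 / real j" by blast
  then have "e (Suc n) = 1 / real j - 1 / real (j + 1)"
    using assms(1)[of n] greedy_step_inverse[of j] by simp
  also have "\<dots> = 1 / real (j * (j + 1))"
    using \<open>j > 0\<close> by (simp add: field_simps)
  finally have "e (Suc n) = 1 / real (j * (j + 1))" .
  with \<open>j > 0\<close> show ?case by (intro exI[of _ "j * (j + 1)"]) simp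
qed

theorem corollary1p7:
  fixes \<theta> :: real and N :: nat and a b :: "nat \<Rightarrow> nat" and e :: "nat \<Rightarrow> real"
  assumes "0 < \<theta>" and "\<theta> \<le> 1"
    and "a = greedy \<theta>"
    and "\<And>m. e m = \<theta> - (\<Sum>n = 1..m. 1 / real (a n))"
    and "N \<ge> 2"
    and "\<And>m. m \<ge> 1 \<Longrightarrow>
           is_arg_max (\<lambda>k. real N / real k) (\<lambda>k. k \<ge> 1 \<and> real N / real k < e (m - 1)) (b m)"
    and "\<theta> \<in> \<rat>"
  shows "\<forall>\<^sub>F m in sequentially. 1 / real (a m) < real N / real (b m)"
proof -
  have a_Suc: "a (Suc m) = greedy_step (e m)" for m
    unfolding assms(3,4) by (rule greedy_Suc)
  have e_Suc: "e (Suc m) = e m - 1 / real (greedy_step (e m))" for m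
    using assms(4)[of m] assms(4)[of "Suc m"] a_Suc[of m] by simp
  from \<open>\<theta> \<in> \<rat>\<close> \<open>0 < \<theta>\<close> obtain p q :: nat where "q \<noteq> 0" "\<theta> = real p / real q"
    by (metis Rats_abs_nat_div_natE abs_of_pos)
  moreover from this \<open>0 < \<theta>\<close> have "p > 0" by (auto intro: gr0I)
  moreover have "e 0 = \<theta>" using assms(4) by simp
  ultimately obtain M k\<^sub>0 where "k\<^sub>0 > 0" "e M = 1 / real k\<^sub>0"
    using greedy_remainder_reaches_inverse[of e 0 p q, OF e_Suc] by auto
  note inverse = greedy_remainder_stays_inverse[of e, OF e_Suc this]
  \<comment> \<open>The bound on \<open>m\<close> is strict because \<open>a m\<close> and
    \<open>b m\<close> are both determined by \<open>e (m - 1)\<close>, so \<open>m - 1\<close> must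
    be at least \<open>M\<close>.\<close>
  have "1 / real (a m) < real N / real (b m)" if "m > M" for m
  proof -
    from that obtain n where m: "m = Suc n" and "M \<le> n" by (cases m) auto
    with inverse obtain k where k: "k > 0" "e n = 1 / real k" by blast
    have pos: "real N * real k + 1 > 0" by (simp add: add_nonneg_pos)
    have "1 / real (a m) = 1 / (real k + 1)"
      using a_Suc[of n] greedy_step_inverse[of k] m k by simp
    \<comment> \<open>Cross-multiplied, this is \<open>N * k + 1 < N * k + N\<close>.\<close>
    also have "\<dots> < real N / real (N * k + 1)"
      using \<open>N \<ge> 2\<close> pos by (simp add: field_simps)
    also have "\<dots> \<le> real N / real (b m)"
    proof -
      \<comment> \<open>As \<open>1 / k = N / (N * k)\<close>, raising the denominator by one gives
        an admissible fraction, which by maximality cannot exceed \<open>N / b m\<close>.\<close>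
      have "real N / real (N * k + 1) < e (m - 1)"
        unfolding m diff_Suc_1 k(2) using k(1) pos by (simp add: field_simps)
      then show ?thesis
        using assms(6)[of m] m unfolding is_arg_max_def
          by (metis le_add2 not_less le_add1 plus_1_eq_Suc)
    qed
    finally show ?thesis .
  qed
  then show ?thesis by (auto simp: eventually_at_top_dense)
qed

end
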